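(* Let $G$ be a finitely generated group and let $K,H$ be subgroups of $G$ with $K\le H$ and $[H:K]<\infty$. If $(G,K)$ is context-free, then $(G,H)$ is also context-free.
   Context: A *semigroup presentation* of a finitely generated group $G$ is a (not necessarily injective) map $\psi:\Sigma\to G$ from a finite alphabet $\Sigma$ such that its extension to a monoid homomorphism $\psi:\Sigma^*\to G$ is surjective. For a subgroup $K\le G$ (not necessarily finitely generated), $L(G,K,\psi)=\{w\in\Sigma^*:\psi(w)\in K\}$. The pair $(G,K)$ is *context-free* if $L(G,K,\psi)$ is a context-free language for some (equivalently, every) semigroup presentation $\psi$ of $G$. *)

theory Defs
  imports "HOL-Algebra.Algebra"
begin

datatype ('n, 't) symb = Nt 'n | Tm 't

record ('n, 't) cfg =
  nonterminals :: "'n set"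
  terminals :: "'t set"
  productions :: "('n \<times> ('n, 't) symb list) set"
  start :: 'n

definition wf_cfg :: "('n, 't) cfg \<Rightarrow> bool" where
  "wf_cfg \<Gamma> \<longleftrightarrow>
     finite (nonterminals \<Gamma>) \<and> finite (terminals \<Gamma>) \<and> finite (productions \<Gamma>) \<and>
     start \<Gamma> \<in> nonterminals \<Gamma> \<and>
     productions \<Gamma> \<subseteq>
       nonterminals \<Gamma> \<times> lists (Nt ` nonterminals \<Gamma> \<union> Tm ` terminals \<Gamma>)"

definition derivation_step ::
  "('n, 't) cfg \<Rightarrow> (('n, 't) symb list \<times> ('n, 't) symb list) set" where
  "derivation_step \<Gamma> =
     {(u @ [Nt A] @ v, u @ \<alpha> @ v) | u A v \<alpha>. (A, \<alpha>) \<in> productions \<Gamma>}"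

definition cfg_language :: "('n, 't) cfg \<Rightarrow> 't list set" where
  "cfg_language \<Gamma> = {w. ([Nt (start \<Gamma>)], map Tm w) \<in> (derivation_step \<Gamma>)\<^sup>*}"

(* Nonterminals may be taken to be natural numbers, since a grammar has only finitely many. *)
definition context_free_language :: "'t set \<Rightarrow> 't list set \<Rightarrow> bool" where
  "context_free_language \<Sigma> L \<longleftrightarrow>
     (\<exists>\<Gamma> :: (nat, 't) cfg. wf_cfg \<Gamma> \<and> terminals \<Gamma> = \<Sigma> \<and> cfg_language \<Gamma> = L)"

definition finitely_generated_group :: "('g, 'm) monoid_scheme \<Rightarrow> bool" where
  "finitely_generated_group G \<longleftrightarrow>
     group G \<and> (\<exists>S. finite S \<and> S \<subseteq> carrier G \<and> generate G S = carrier G)"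

definition word_value :: "('g, 'm) monoid_scheme \<Rightarrow> ('a \<Rightarrow> 'g) \<Rightarrow> 'a list \<Rightarrow> 'g" where
  "word_value G \<psi> w = foldr (\<lambda>a g. \<psi> a \<otimes>\<^bsub>G\<^esub> g) w \<one>\<^bsub>G\<^esub>"

definition semigroup_presentation ::
  "('g, 'm) monoid_scheme \<Rightarrow> 'a set \<Rightarrow> ('a \<Rightarrow> 'g) \<Rightarrow> bool" where
  "semigroup_presentation G \<Sigma> \<psi> \<longleftrightarrow>
     finite \<Sigma> \<and> \<psi> \<in> \<Sigma> \<rightarrow> carrier G \<and> word_value G \<psi> ` lists \<Sigma> = carrier G"

definition word_language ::
  "('g, 'm) monoid_scheme \<Rightarrow> 'g set \<Rightarrow> 'a set \<Rightarrow> ('a \<Rightarrow> 'g) \<Rightarrow> 'a list set" where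
  "word_language G K \<Sigma> \<psi> = {w \<in> lists \<Sigma>. word_value G \<psi> w \<in> K}"

(* Every finite alphabet is in bijection with a finite set of natural numbers, so alphabets
   inside nat give all semigroup presentations up to renaming of letters. *)
definition context_free_pair :: "('g, 'm) monoid_scheme \<Rightarrow> 'g set \<Rightarrow> bool" where
  "context_free_pair G K \<longleftrightarrow>
     (\<exists>(\<Sigma> :: nat set) \<psi>. semigroup_presentation G \<Sigma> \<psi> \<and>
        context_free_language \<Sigma> (word_language G K \<Sigma> \<psi>))"

definition finite_index :: "('g, 'm) monoid_scheme \<Rightarrow> 'g set \<Rightarrow> 'g set \<Rightarrow> bool" where
  "finite_index G H K \<longleftrightarrow> finite (rcosets\<^bsub>G\<lparr>carrier := H\<rparr>\<^esub> K)"

end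

(* If u ranges over words representing the inverses of representatives of the finitely many cosets
   K h in H, then a word w represents an element of H iff some w u represents an element of K.
   So the language of H is the right quotient of the language of K by a finite set of words, and
   context-free languages are closed under such quotients: a nonterminal (A, v) is made to produce
   the words w such that A produces w v. *)
theory Submission
  imports Defs
begin

section \<open>Parse relation of a grammar and its agreement with derivations\<close>

text \<open>A parse forest read from left to right. It forgets the order of rewriting steps, so
  proofs can induct on the symbols of the sentential form instead of on derivation
  sequences.\<close>

inductive yields :: "('n \<times> ('n, 't) symb list) set \<Rightarrow> ('n, 't) symb list \<Rightarrow> 't list \<Rightarrow> bool"
  for P where
  Nil: "yields P [] []"
| Tm: "yields P \<alpha> w \<Longrightarrow> yields P (Tm a # \<alpha>) (a # w)"
| Nt: "\<lbrakk>(A, \<beta>) \<in> P; yields P \<beta> u; yields P \<alpha> w\<rbrakk> \<Longrightarrow> yields P (Nt A # \<alpha>) (u @ w)"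

lemma yields_Nil_iff [simp]: "yields P [] w \<longleftrightarrow> w = []"
  by (subst yields.simps) auto

lemma yields_single_Nt_iff: "yields P [Nt A] w \<longleftrightarrow> (\<exists>\<beta>. (A, \<beta>) \<in> P \<and> yields P \<beta> w)"
  by (subst yields.simps) auto

lemma yields_append: "yields P \<alpha> u \<Longrightarrow> yields P \<beta> w \<Longrightarrow> yields P (\<alpha> @ \<beta>) (u @ w)"
proof (induction rule: yields.induct)
  case (Nt A \<gamma> u \<alpha> v)
  then show ?case using yields.Nt[of A \<gamma> P u "\<alpha> @ \<beta>" "v @ w"] by simp
qed (auto intro: yields.intros)

text \<open>Each symbol contributes its own factor of the word, so cutting the form cuts the word
  accordingly.\<close>

lemma yields_appendE:
  assumes "yields P (\<alpha> @ \<beta>) w"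
  obtains u v where "w = u @ v" "yields P \<alpha> u" "yields P \<beta> v"
proof -
  have "\<exists>u v. w = u @ v \<and> yields P \<alpha> u \<and> yields P \<beta> v"
    using assms
  proof (induction "\<alpha> @ \<beta>" w arbitrary: \<alpha> rule: yields.induct)
    case Nil
    then show ?case by (auto intro: yields.Nil)
  next
    case (Tm \<delta> w a)
    show ?case
    proof (cases \<alpha>)
      case Nil
      then show ?thesis using Tm by (auto intro: yields.intros)
    next
      case (Cons Y \<alpha>')
      with Tm obtain u v where "w = u @ v" "yields P \<alpha>' u" "yields P \<beta> v" by auto
      with Cons Tm(3) show ?thesis
        by (intro exI[of _ "a # u"] exI[of _ v]) (auto intro: yields.intros)
    qed
  next
    case (Nt A \<gamma> x \<delta> y)
    show ?case
    proof (cases \<alpha>)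
      case Nil
      then show ?thesis using Nt by (metis append_Nil yields.Nil yields.Nt)
    next
      case (Cons Y \<alpha>')
      with Nt obtain u v where "y = u @ v" "yields P \<alpha>' u" "yields P \<beta> v" by auto
      with Cons Nt show ?thesis
        by (intro exI[of _ "x @ u"] exI[of _ v]) (auto intro: yields.intros)
    qed
  qed
  then show thesis using that by blast
qed

lemma yields_map_Tm: "yields P (map Tm w) w"
  by (induction w) (auto intro: yields.intros)

lemma derivation_step_context:
  assumes "(\<alpha>, \<beta>) \<in> (derivation_step \<Gamma>)\<^sup>*"
  shows "(u @ \<alpha> @ v, u @ \<beta> @ v) \<in> (derivation_step \<Gamma>)\<^sup>*"
  using assms
proof (induction rule: rtrancl_induct)
  case (step \<beta> \<gamma>)
  then obtain x A y \<delta> where "\<beta> = x @ [Nt A] @ y" "\<gamma> = x @ \<delta> @ y" "(A, \<delta>) \<in> productions \<Gamma>"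
    unfolding derivation_step_def by blast
  then have "((u @ x) @ [Nt A] @ (y @ v), (u @ x) @ \<delta> @ (y @ v)) \<in> derivation_step \<Gamma>"
    unfolding derivation_step_def by blast
  with \<open>\<beta> = _\<close> \<open>\<gamma> = _\<close> have "(u @ \<beta> @ v, u @ \<gamma> @ v) \<in> derivation_step \<Gamma>" by simp
  with step.IH show ?case by (rule rtrancl_into_rtrancl)
qed simp

text \<open>A rewriting step replaces one nonterminal, whose factor of \<open>w\<close> is isolated
  by \<open>yields_appendE\<close>. Conversely, a nonterminal is rewritten in place, then its
  right-hand side is derived to the end, then the rest of the form.\<close>

lemma derivation_iff_yields:
  "(\<alpha>, map Tm w) \<in> (derivation_step \<Gamma>)\<^sup>* \<longleftrightarrow> yields (productions \<Gamma>) \<alpha> w"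
proof
  assume "(\<alpha>, map Tm w) \<in> (derivation_step \<Gamma>)\<^sup>*"
  then show "yields (productions \<Gamma>) \<alpha> w"
  proof (induction rule: converse_rtrancl_induct)
    case base
    show ?case by (rule yields_map_Tm)
  next
    case (step \<alpha> \<beta>)
    then obtain u A v \<delta> where 1: "\<alpha> = u @ [Nt A] @ v" "\<beta> = u @ \<delta> @ v" "(A, \<delta>) \<in> productions \<Gamma>"
      unfolding derivation_step_def by blast
    with step.IH obtain x y z where "w = x @ y @ z" "yields (productions \<Gamma>) u x"
      "yields (productions \<Gamma>) \<delta> y" "yields (productions \<Gamma>) v z"
      by (metis yields_appendE)
    with 1 show ?case by (auto intro!: yields_append yields.Nt)
  qed
next
  assume "yields (productions \<Gamma>) \<alpha> w"
  then show "(\<alpha>, map Tm w) \<in> (derivation_step \<Gamma>)\<^sup>*"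
  proof (induction rule: yields.induct)
    case (Tm \<alpha> w a)
    then show ?case using derivation_step_context[of \<alpha> "map Tm w" \<Gamma> "[Tm a]" "[]"] by simp
  next
    case (Nt A \<beta> u \<alpha> w)
    have "(Nt A # \<alpha>, \<beta> @ \<alpha>) \<in> derivation_step \<Gamma>"
      using Nt(1) unfolding derivation_step_def by force
    also have "(\<beta> @ \<alpha>, map Tm u @ \<alpha>) \<in> (derivation_step \<Gamma>)\<^sup>*"
      using derivation_step_context[OF Nt.IH(1), of "[]" \<alpha>] by simp
    also have "(map Tm u @ \<alpha>, map Tm u @ map Tm w) \<in> (derivation_step \<Gamma>)\<^sup>*"
      using derivation_step_context[OF Nt.IH(2), of "map Tm u" "[]"] by simp
    finally show ?case by simp
  qed simp
qed

lemma cfg_language_eq_yields: "cfg_language \<Gamma> = {w. yields (productions \<Gamma>) [Nt (start \<Gamma>)] w}"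
  by (simp add: cfg_language_def derivation_iff_yields)

section \<open>Renaming of nonterminals\<close>

text \<open>Applied below both to an encoding \<open>f\<close> of the nonterminals and to its left
  inverse \<open>g\<close>, one for each inclusion between the languages.\<close>

lemma yields_rename:
  "yields P \<alpha> w \<Longrightarrow>
   yields (map_prod f (map (map_symb f id)) ` P) (map (map_symb f id) \<alpha>) w"
  by (induction rule: yields.induct) (auto intro!: yields.intros intro: rev_image_eqI)

text \<open>Lets a grammar be built over any convenient type of nonterminals, such as pairs of a
  nonterminal and a suffix, although \<open>context_free_language\<close> asks for natural
  numbers.\<close>

lemma context_free_languageI:
  fixes \<Gamma> :: "('n, 't) cfg"
  assumes wf: "wf_cfg \<Gamma>"
  shows "context_free_language (terminals \<Gamma>) (cfg_language \<Gamma>)"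
proof -
  obtain f :: "'n \<Rightarrow> nat" where inj: "inj_on f (nonterminals \<Gamma>)"
    using wf finite_imp_inj_to_nat_seg unfolding wf_cfg_def by metis
  define g where "g = inv_into (nonterminals \<Gamma>) f"
  let ?m = "\<lambda>f. map_prod f (map (map_symb f id))"
  define \<Delta> :: "(nat, 't) cfg" where "\<Delta> = \<lparr>nonterminals = f ` nonterminals \<Gamma>,
    terminals = terminals \<Gamma>, productions = ?m f ` productions \<Gamma>, start = f (start \<Gamma>)\<rparr>"
  have rhs: "set \<alpha> \<subseteq> Nt ` nonterminals \<Gamma> \<union> Tm ` terminals \<Gamma>" "A \<in> nonterminals \<Gamma>"
    if "(A, \<alpha>) \<in> productions \<Gamma>" for A \<alpha>
    using wf that unfolding wf_cfg_def by auto
  have g: "g (f A) = A" if "A \<in> nonterminals \<Gamma>" for A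
    using that inj by (simp add: g_def)
  have g_symb: "map_symb g id (map_symb f id Y) = Y"
    if "Y \<in> Nt ` nonterminals \<Gamma> \<union> Tm ` terminals \<Gamma>" for Y :: "('n, 't) symb"
    using that g by auto
  \<comment> \<open>\<open>g\<close> is known to undo \<open>f\<close> only on the nonterminals of
    \<Gamma>; well-formedness keeps all right-hand sides within that range.\<close>
  have "map (map_symb g id) (map (map_symb f id) \<alpha>) = \<alpha>" if "(A, \<alpha>) \<in> productions \<Gamma>" for A \<alpha>
    unfolding map_map by (rule map_idI) (use rhs(1)[OF that] g_symb in auto)
  then have "?m g (?m f p) = p" if "p \<in> productions \<Gamma>" for p
    using that rhs(2) g by (cases p) (auto simp del: map_map)
  then have g_f: "?m g ` ?m f ` productions \<Gamma> = productions \<Gamma>"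
    unfolding image_image by simp
  have start: "start \<Gamma> \<in> nonterminals \<Gamma>" using wf by (simp add: wf_cfg_def)
  have "wf_cfg \<Delta>"
    unfolding wf_cfg_def
  proof (intro conjI)
    show "productions \<Delta> \<subseteq>
        nonterminals \<Delta> \<times> lists (Nt ` nonterminals \<Delta> \<union> Tm ` terminals \<Delta>)"
      using rhs by (fastforce simp: \<Delta>_def)
  qed (use wf in \<open>auto simp: \<Delta>_def wf_cfg_def\<close>)
  moreover have "cfg_language \<Delta> = cfg_language \<Gamma>"
  proof -
    have "yields (productions \<Gamma>) [Nt (start \<Gamma>)] w"
      if "yields (productions \<Delta>) [Nt (start \<Delta>)] w" for w
      using yields_rename[OF that, of g] start g by (simp add: \<Delta>_def g_f)
    moreover have "yields (productions \<Delta>) [Nt (start \<Delta>)] w"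
      if "yields (productions \<Gamma>) [Nt (start \<Gamma>)] w" for w
      using yields_rename[OF that, of f] by (simp add: \<Delta>_def)
    ultimately show ?thesis by (auto simp: cfg_language_eq_yields)
  qed
  moreover have "terminals \<Delta> = terminals \<Gamma>" by (simp add: \<Delta>_def)
  ultimately show ?thesis unfolding context_free_language_def by metis
qed

section \<open>Right quotients of context-free languages by finite sets of words\<close>

text \<open>
  The sentential form \<open>\<alpha>\<close> minus the suffix \<open>v\<close>: the cut before \<open>v\<close> falls either between two
  symbols of \<open>\<alpha>\<close> or inside a nonterminal \<open>B\<close>, which then becomes \<open>(B, v1)\<close>. Symbols left of the
  cut get the suffix \<open>[]\<close>. The nonterminal \<open>None\<close> is reserved for the new start symbol.
\<close>
inductive cut :: "('n \<times> ('n, 't) symb list) set \<Rightarrow> 't list \<Rightarrow> ('n, 't) symb list \<Rightarrow>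
    (('n \<times> 't list) option, 't) symb list \<Rightarrow> bool"
  for P v where
  between: "yields P \<alpha> v \<Longrightarrow> cut P v \<alpha> []"
| inside: "v = v1 @ v2 \<Longrightarrow> yields P \<alpha> v2 \<Longrightarrow> cut P v (Nt B # \<alpha>) [Nt (Some (B, v1))]"
| Cons: "cut P v \<alpha> \<rho> \<Longrightarrow> cut P v (Y # \<alpha>) (map_symb (\<lambda>B. Some (B, [])) id Y # \<rho>)"

inductive_cases cut_NilE: "cut P v \<alpha> []"
inductive_cases cut_ConsE: "cut P v \<alpha> (Y # \<rho>)"

lemma map_symb_eq_Tm_iff: "Tm a = map_symb f id Y \<longleftrightarrow> Y = Tm a"
  by (cases Y) auto

text \<open>This bound and \<open>set_cut\<close> leave only finitely many right-hand sides, which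
  makes the quotient grammar finite.\<close>

lemma length_cut: "cut P v \<alpha> \<rho> \<Longrightarrow> length \<rho> \<le> length \<alpha>"
  by (induction rule: cut.induct) auto

lemma set_cut:
  assumes "cut P v \<alpha> \<rho>" "set \<alpha> \<subseteq> Nt ` N \<union> Tm ` T"
    and "[] \<in> V" "\<And>v1 v2. v = v1 @ v2 \<Longrightarrow> v1 \<in> V"
  shows "set \<rho> \<subseteq> Nt ` Some ` (N \<times> V) \<union> Tm ` T"
  using assms by (induction rule: cut.induct) auto

text \<open>Every way of cutting \<open>v\<close> off a right-hand side gives its own production, so
  a derivation guesses where the cut falls; \<open>None\<close> first guesses the word of
  \<open>U\<close> to be removed.\<close>

definition quotient_productions ::
  "('n \<times> ('n, 't) symb list) set \<Rightarrow> 't list set \<Rightarrow> 'n \<Rightarrow> 't list set \<Rightarrow>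
   (('n \<times> 't list) option \<times> (('n \<times> 't list) option, 't) symb list) set" where
  "quotient_productions P V S U =
     {(None, [Nt (Some (S, u))]) | u. u \<in> U} \<union>
     {(Some (A, v), \<rho>) | A v \<rho>. v \<in> V \<and> (\<exists>\<alpha>. (A, \<alpha>) \<in> P \<and> cut P v \<alpha> \<rho>)}"

text \<open>Induction with \<alpha> and \<open>v\<close> arbitrary, since descending into
  \<open>Some (B, v')\<close> replaces the suffix by \<open>v'\<close> and the form by a right-hand
  side of \<open>B\<close>.\<close>

lemma quotient_yields_imp_yields:
  assumes "yields (quotient_productions P V S U) \<rho> w" and "cut P v \<alpha> \<rho>"
  shows "yields P \<alpha> (w @ v)"
  using assms
proof (induction arbitrary: \<alpha> v rule: yields.induct)
  case Nil
  then show ?case by (auto elim: cut_NilE)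
next
  case (Tm \<rho> w a)
  from Tm.prems obtain \<beta> where "\<alpha> = Tm a # \<beta>" "cut P v \<beta> \<rho>"
    by (rule cut_ConsE) (auto simp: map_symb_eq_Tm_iff)
  with Tm.IH show ?case by (auto intro: yields.Tm)
next
  case (Nt Y \<delta> u \<rho> w)
  \<comment> \<open>A production of \<open>Some (B, v')\<close> is a cut of a right-hand side of
    \<open>B\<close> by \<open>v'\<close>, so the induction hypothesis puts that suffix back after
    \<open>u\<close>.\<close>
  have *: "\<exists>\<beta>. (B, \<beta>) \<in> P \<and> yields P \<beta> (u @ v')" if "Y = Some (B, v')" for B v'
    using Nt.hyps(1) Nt.IH(1) that unfolding quotient_productions_def by auto
  from Nt.prems show ?case
  proof (rule cut_ConsE)
    fix v1 v2 \<beta> B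
    assume 1: "Nt Y = (Nt (Some (B, v1)) :: (_, 'b) symb)" "\<rho> = []" "\<alpha> = Nt B # \<beta>" "v = v1 @ v2"
      "yields P \<beta> v2"
    with Nt.hyps(3) have "w = []" by simp
    with 1 * show ?thesis using yields.Nt[of B _ P "u @ v1" \<beta> v2] by auto
  next
    fix \<beta> Z
    assume 1: "Nt Y = map_symb (\<lambda>B. Some (B, [])) id Z" "\<alpha> = Z # \<beta>" "cut P v \<beta> \<rho>"
    then obtain B where "Z = Nt B" "Y = Some (B, [])" by (cases Z) auto
    with 1 * Nt.IH(2) show ?thesis using yields.Nt[of B _ P u \<beta> "w @ v"] by auto
  qed
qed

text \<open>Cut \<alpha> where the parse of \<open>w @ v\<close> passes from \<open>w\<close> to
  \<open>v\<close>. If this happens within the factor of a nonterminal, a prefix of \<open>v\<close>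
  becomes the suffix to remove there, whence the closure of \<open>V\<close> under prefixes.\<close>

lemma yields_imp_quotient_yields:
  assumes "yields P \<alpha> (w @ v)" and "v \<in> V" and V: "\<And>v1 v2. v1 @ v2 \<in> V \<Longrightarrow> v1 \<in> V"
  shows "\<exists>\<rho>. cut P v \<alpha> \<rho> \<and> yields (quotient_productions P V S U) \<rho> w"
  using assms(1,2)
proof (induction \<alpha> "w @ v" arbitrary: w v rule: yields.induct)
  case Nil
  then show ?case by (auto intro!: exI[of _ "[]"] cut.between yields.Nil)
next
  case (Tm \<alpha> x a)
  show ?case
  proof (cases w)
    case Nil
    with Tm have "yields P (Tm a # \<alpha>) v" by (metis append_Nil yields.Tm)
    with Nil show ?thesis by (auto intro!: exI[of _ "[]"] cut.between yields.Nil)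
  next
    case (Cons b w')
    with Tm obtain \<rho> where "cut P v \<alpha> \<rho>" "yields (quotient_productions P V S U) \<rho> w'" "b = a"
      by auto
    with Cons show ?thesis
      using cut.Cons[of P v \<alpha> \<rho> "Tm a"] by (auto intro!: exI[of _ "Tm a # \<rho>"] yields.Tm)
  qed
next
  case (Nt A \<beta> u \<alpha> y)
  let ?Q = "quotient_productions P V S U"
  \<comment> \<open>Serves both cases below: \<open>v1 = []\<close> for a nonterminal left of the
    cut, and the part of \<open>v\<close> produced by \<open>A\<close> when the cut falls inside
    \<open>A\<close>.\<close>
  have pair: "yields ?Q (Nt (Some (A, v1)) # \<rho>) (w1 @ w2)"
    if "u = w1 @ v1" "v1 \<in> V" "yields ?Q \<rho> w2" for w1 v1 \<rho> w2
  proof -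
    from Nt(3) that obtain \<sigma> where "cut P v1 \<beta> \<sigma>" "yields ?Q \<sigma> w1" by blast
    moreover from this Nt(1) that have "(Some (A, v1), \<sigma>) \<in> ?Q"
      unfolding quotient_productions_def by auto
    ultimately show ?thesis using yields.Nt[of "Some (A, v1)" \<sigma> ?Q w1 \<rho> w2] that(3) by blast
  qed
  from \<open>u @ y = w @ v\<close> consider
    w' where "w = u @ w'" "y = w' @ v" | v1 where "u = w @ v1" "v = v1 @ y"
    by (auto simp: append_eq_append_conv2)
  then show ?case
  proof cases
    case 1
    with Nt obtain \<rho> where \<rho>: "cut P v \<alpha> \<rho>" "yields ?Q \<rho> w'" by blast
    have "[] \<in> V" using Nt.prems V[of "[]" v] by simp
    with pair[of u "[]"] \<rho> 1 cut.Cons[OF \<rho>(1), of "Nt A"] show ?thesis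
      by (intro exI[of _ "Nt (Some (A, [])) # \<rho>"]) auto
  next
    case 2
    then have "v1 \<in> V" using V Nt.prems by blast
    with pair[of w v1 "[]" "[]"] 2 cut.inside[OF 2(2) Nt(4)] show ?thesis
      by (intro exI[of _ "[Nt (Some (A, v1))]"]) (auto intro: yields.Nil)
  qed
qed

lemma context_free_language_right_quotient:
  assumes "context_free_language \<Sigma> L" and "finite U" and "U \<subseteq> lists \<Sigma>"
  shows "context_free_language \<Sigma> {w. \<exists>u\<in>U. w @ u \<in> L}"
proof -
  obtain \<Gamma> :: "(nat, 'a) cfg" where wf: "wf_cfg \<Gamma>" and \<Sigma>: "terminals \<Gamma> = \<Sigma>"
    and L: "cfg_language \<Gamma> = L"
    using assms(1) unfolding context_free_language_def by blast
  let ?N = "nonterminals \<Gamma>" and ?P = "productions \<Gamma>" and ?S = "start \<Gamma>"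
  have fin: "finite ?N" "finite \<Sigma>" "finite ?P" and S: "?S \<in> ?N"
    using wf \<Sigma> by (auto simp: wf_cfg_def)
  have P: "A \<in> ?N" "set \<alpha> \<subseteq> Nt ` ?N \<union> Tm ` \<Sigma>" if "(A, \<alpha>) \<in> ?P" for A \<alpha>
    using wf \<Sigma> that by (auto simp: wf_cfg_def)
  obtain n where n: "length u \<le> n" if "u \<in> U" for u
    using finite_nat_set_iff_bounded_le[of "length ` U"] assms(2) by auto
  obtain m where m: "length \<alpha> \<le> m" if "(A, \<alpha>) \<in> ?P" for A \<alpha>
    using finite_nat_set_iff_bounded_le[of "(length \<circ> snd) ` ?P"] fin(3) by force
  \<comment> \<open>Bounding the length by that of the longest words in \<open>U\<close> gives a
    finite set that contains \<open>U\<close> and is closed under prefixes, hence contains every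
    suffix that can arise.\<close>
  define V where "V = {v. set v \<subseteq> \<Sigma> \<and> length v \<le> n}"
  have V: "finite V" "[] \<in> V" "\<And>v1 v2. v1 @ v2 \<in> V \<Longrightarrow> v1 \<in> V" "U \<subseteq> V"
    using finite_lists_length_le[OF fin(2)] n assms(3) by (auto simp: V_def)
  define Q where "Q = quotient_productions ?P V ?S U"
  define M where "M = insert None (Some ` (?N \<times> V))"
  \<comment> \<open>The 1 in \<open>max 1 m\<close> accounts for the start productions; the others
    are no longer than the right-hand sides they are cut from.\<close>
  have Q: "Y \<in> M \<and> set \<rho> \<subseteq> Nt ` M \<union> Tm ` \<Sigma> \<and> length \<rho> \<le> max 1 m" if "(Y, \<rho>) \<in> Q" for Y \<rho>
  proof -
    from that consider u where "Y = None" "\<rho> = [Nt (Some (?S, u))]" "u \<in> U"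
      | A v \<alpha> where "Y = Some (A, v)" "v \<in> V" "(A, \<alpha>) \<in> ?P" "cut ?P v \<alpha> \<rho>"
      unfolding Q_def quotient_productions_def by auto
    then show ?thesis
    proof cases
      case 1
      then show ?thesis using S V(4) by (auto simp: M_def)
    next
      case 2
      have "set \<rho> \<subseteq> Nt ` Some ` (?N \<times> V) \<union> Tm ` \<Sigma>"
        using set_cut[OF 2(4) P(2)[OF 2(3)] V(2)] V(3) 2(2) by blast
      moreover have "length \<rho> \<le> m" using length_cut[OF 2(4)] m[OF 2(3)] by simp
      ultimately show ?thesis using 2 P(1) by (auto simp: M_def)
    qed
  qed
  have "finite M" using fin V by (simp add: M_def)
  have "Q \<subseteq> M \<times> {\<rho>. set \<rho> \<subseteq> Nt ` M \<union> Tm ` \<Sigma> \<and> length \<rho> \<le> max 1 m}"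
    using Q by auto
  then have "finite Q"
    by (rule finite_subset)
      (use \<open>finite M\<close> fin in \<open>intro finite_cartesian_product finite_lists_length_le finite_UnI finite_imageI\<close>)
  define \<Delta> where "\<Delta> = \<lparr>nonterminals = M, terminals = \<Sigma>, productions = Q, start = None\<rparr>"
  have "wf_cfg \<Delta>"
    unfolding wf_cfg_def
  proof (intro conjI)
    show "productions \<Delta> \<subseteq>
        nonterminals \<Delta> \<times> lists (Nt ` nonterminals \<Delta> \<union> Tm ` terminals \<Delta>)"
      using Q by (auto simp: \<Delta>_def in_lists_conv_set)
  qed (use \<open>finite M\<close> \<open>finite Q\<close> fin in \<open>auto simp: \<Delta>_def M_def\<close>)
  moreover have "cfg_language \<Delta> = {w. \<exists>u\<in>U. w @ u \<in> L}"
  proof -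
    have "yields Q [Nt None] w \<longleftrightarrow> (\<exists>u\<in>U. yields Q [Nt (Some (?S, u))] w)" for w
      by (subst yields_single_Nt_iff) (auto simp: Q_def quotient_productions_def)
    moreover have "yields Q [Nt (Some (?S, u))] w \<longleftrightarrow> yields ?P [Nt ?S] (w @ u)" if "u \<in> U" for u w
    proof
      assume "yields Q [Nt (Some (?S, u))] w"
      \<comment> \<open>The one-symbol form of the old start symbol is cut inside that symbol, with
        \<open>v1 = u\<close> and \<open>v2 = []\<close>.\<close>
      then show "yields ?P [Nt ?S] (w @ u)"
        unfolding Q_def
        by (rule quotient_yields_imp_yields) (auto intro: cut.inside yields.Nil)
    next
      assume "yields ?P [Nt ?S] (w @ u)"
      then obtain \<alpha> where \<alpha>: "(?S, \<alpha>) \<in> ?P" "yields ?P \<alpha> (w @ u)"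
        unfolding yields_single_Nt_iff by blast
      from that V(4) have "u \<in> V" by blast
      from yields_imp_quotient_yields[OF \<alpha>(2) this, of ?S U] V(3) obtain \<rho>
        where "cut ?P u \<alpha> \<rho>" and \<rho>: "yields Q \<rho> w" unfolding Q_def by blast
      with \<alpha> \<open>u \<in> V\<close> have "(Some (?S, u), \<rho>) \<in> Q"
        by (auto simp: Q_def quotient_productions_def)
      with \<rho> show "yields Q [Nt (Some (?S, u))] w" unfolding yields_single_Nt_iff by blast
    qed
    ultimately show ?thesis
      using L by (auto simp: cfg_language_eq_yields \<Delta>_def)
  qed
  ultimately show ?thesis using context_free_languageI[of \<Delta>] by (simp add: \<Delta>_def)
qed

section \<open>Word languages of subgroups\<close>

context group
begin

lemma word_value_closed:
  "\<psi> \<in> \<Sigma> \<rightarrow> carrier G \<Longrightarrow> w \<in> lists \<Sigma> \<Longrightarrow> word_value G \<psi> w \<in> carrier G"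
  by (induction w) (auto simp: word_value_def)

lemma word_value_append:
  "\<psi> \<in> \<Sigma> \<rightarrow> carrier G \<Longrightarrow> u \<in> lists \<Sigma> \<Longrightarrow> w \<in> lists \<Sigma> \<Longrightarrow>
   word_value G \<psi> (u @ w) = word_value G \<psi> u \<otimes> word_value G \<psi> w"
proof (induction u)
  case Nil
  then show ?case using word_value_closed[of \<psi> \<Sigma> w] by (simp add: word_value_def)
next
  case (Cons a u)
  then show ?case
    using word_value_closed[of \<psi> \<Sigma> w] word_value_closed[of \<psi> \<Sigma> u]
    by (auto simp: word_value_def m_assoc Pi_iff)
qed

lemma word_language_finite_index_quotient:
  assumes K: "subgroup K G" and H: "subgroup H G" and "K \<subseteq> H" and "finite_index G H K"
    and \<psi>: "semigroup_presentation G \<Sigma> \<psi>"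
  obtains U where "finite U" "U \<subseteq> lists \<Sigma>"
    "word_language G H \<Sigma> \<psi> = {w. \<exists>u\<in>U. w @ u \<in> word_language G K \<Sigma> \<psi>}"
proof -
  let ?C = "rcosets\<^bsub>G\<lparr>carrier := H\<rparr>\<^esub> K"
  have fin: "finite ?C" using assms(4) by (simp add: finite_index_def)
  have \<psi>_closed: "\<psi> \<in> \<Sigma> \<rightarrow> carrier G" and surj: "word_value G \<psi> ` lists \<Sigma> = carrier G"
    using \<psi> by (auto simp: semigroup_presentation_def)
  \<comment> \<open>Cosets depend only on the multiplication, so those formed in the group with
    carrier \<open>H\<close> are cosets in \<open>G\<close>.\<close>
  have coset: "C \<in> ?C \<longleftrightarrow> (\<exists>h\<in>H. C = K #> h)" for C
    by (auto simp: RCOSETS_def r_coset_def)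
  \<comment> \<open>Words over \<Sigma> represent every element of \<open>G\<close>, in particular
    \<open>inv h\<close>.\<close>
  have "\<exists>u\<in>lists \<Sigma>. \<exists>h\<in>H. C = K #> h \<and> word_value G \<psi> u = inv h" if "C \<in> ?C" for C
    using that surj H unfolding coset
    by (metis imageE inv_closed subgroup.mem_carrier)
  then obtain u where u: "\<And>C. C \<in> ?C \<Longrightarrow>
      u C \<in> lists \<Sigma> \<and> (\<exists>h\<in>H. C = K #> h \<and> word_value G \<psi> (u C) = inv h)"
    by metis
  have "word_language G H \<Sigma> \<psi> = {w. \<exists>v\<in>u ` ?C. w @ v \<in> word_language G K \<Sigma> \<psi>}"
  proof (intro Set.set_eqI iffI)
    fix w assume "w \<in> word_language G H \<Sigma> \<psi>"
    then have w: "w \<in> lists \<Sigma>" "word_value G \<psi> w \<in> H" by (auto simp: word_language_def)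
    let ?D = "K #> word_value G \<psi> w"
    have D: "?D \<in> ?C" using w coset by blast
    then obtain h where h: "u ?D \<in> lists \<Sigma>" "h \<in> H" "?D = K #> h"
      "word_value G \<psi> (u ?D) = inv h"
      using u by blast
    have mem: "word_value G \<psi> w \<in> carrier G" "h \<in> carrier G"
      using w h H by (auto dest: subgroup.mem_carrier)
    \<comment> \<open>The chosen \<open>h\<close> may differ from the value of \<open>w\<close>;
      equality of their cosets is what relates them.\<close>
    have "word_value G \<psi> w \<in> K #> h" using rcos_self[OF mem(1) K] h(3) by simp
    then have "word_value G \<psi> w \<otimes> inv h \<in> K"
      using K mem by (auto simp: r_coset_def m_assoc dest: subgroup.mem_carrier)
    then have "w @ u ?D \<in> word_language G K \<Sigma> \<psi>"
      using w h word_value_append[OF \<psi>_closed] by (simp add: word_language_def)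
    with D show "w \<in> {w. \<exists>v\<in>u ` ?C. w @ v \<in> word_language G K \<Sigma> \<psi>}" by blast
  next
    fix w assume "w \<in> {w. \<exists>v\<in>u ` ?C. w @ v \<in> word_language G K \<Sigma> \<psi>}"
    then obtain C where C: "C \<in> ?C" "w @ u C \<in> word_language G K \<Sigma> \<psi>" by blast
    then obtain h where h: "u C \<in> lists \<Sigma>" "h \<in> H" "word_value G \<psi> (u C) = inv h"
      using u by blast
    have w: "w \<in> lists \<Sigma>" using C by (auto simp: word_language_def)
    have mem: "word_value G \<psi> w \<in> carrier G" "h \<in> carrier G"
      using w h H word_value_closed[OF \<psi>_closed] by (auto dest: subgroup.mem_carrier)
    have "word_value G \<psi> w \<otimes> inv h \<in> H"
      using C h w word_value_append[OF \<psi>_closed w h(1)] \<open>K \<subseteq> H\<close> by (auto simp: word_language_def)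
    \<comment> \<open>Both the product and \<open>h\<close> lie in \<open>H\<close>, and cancelling
      \<open>h\<close> recovers the value of \<open>w\<close>.\<close>
    then have "word_value G \<psi> w \<otimes> inv h \<otimes> h \<in> H"
      using h H by (simp add: subgroup.m_closed)
    then show "w \<in> word_language G H \<Sigma> \<psi>"
      using mem w by (simp add: m_assoc word_language_def)
  qed
  with that[of "u ` ?C"] fin u show thesis by blast
qed

end

theorem lemma4p11:
  fixes G :: "('g, 'm) monoid_scheme" and K H :: "'g set"
  assumes "finitely_generated_group G"
    and "subgroup K G"
    and "subgroup H G"
    and "K \<subseteq> H"
    and "finite_index G H K"
    and "context_free_pair G K"
  shows "context_free_pair G H"
proof -
  interpret group G using assms(1) by (simp add: finitely_generated_group_def)
  \<comment> \<open>The presentation that witnesses context-freeness for \<open>K\<close> is kept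
    for \<open>H\<close>.\<close>
  obtain \<Sigma> :: "nat set" and \<psi> where \<psi>: "semigroup_presentation G \<Sigma> \<psi>"
    and cf: "context_free_language \<Sigma> (word_language G K \<Sigma> \<psi>)"
    using assms(6) unfolding context_free_pair_def by blast
  obtain U where "finite U" "U \<subseteq> lists \<Sigma>"
    "word_language G H \<Sigma> \<psi> = {w. \<exists>u\<in>U. w @ u \<in> word_language G K \<Sigma> \<psi>}"
    using word_language_finite_index_quotient[OF assms(2-5) \<psi>] by blast
  then have "context_free_language \<Sigma> (word_language G H \<Sigma> \<psi>)"
    using context_free_language_right_quotient[OF cf] by simp
  with \<psi> show ?thesis unfolding context_free_pair_def by blast
qed

end
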